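(* Let $X$ be a real vector space and let $C, D \subseteq X$ be convex sets. For any face $A$ of the convex set $C \cap D$, we have $$A = F_C(A) \cap F_D(A),$$ where $F_C(A)$ (resp. $F_D(A)$) denotes the face of $C$ (resp. of $D$) generated by $A$.
   Context: Vector spaces are real, of arbitrary (possibly infinite) dimension, with no topology. A convex cone contains the origin and is closed under addition and under multiplication by positive scalars; it is pointed if $K \cap (-K) = \{0\}$. An oriented affine map $f: X \to (Y, Y_+)$ is an affine map from $X$ to a real vector space $Y$ equipped with a pointed convex cone $Y_+ \subseteq Y$ (which defines the partial order $y \le y' \iff y'-y \in Y_+$); it is positive on a set $S \subseteq X$ if $f(S) \subseteq Y_+$; $\ker f := f^{-1}(0)$. A face of a convex set $C \subseteq X$ is a set of the form $C \cap \ker f$ for some oriented affine map $f: X \to (Y, Y_+)$ that is positive on $C$ (in particular $\varnothing$ and $C$ are faces of $C$). For convex sets $C, D \subseteq X$, the generated face $F_C(D)$ is the smallest (with respect to inclusion) face of $C$ that contains $C \cap D$. *)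

theory Defs
  imports "HOL-Analysis.Analysis"
begin

definition affine_map :: "('a::real_vector \<Rightarrow> 'b::real_vector) \<Rightarrow> bool"
  where "affine_map f \<longleftrightarrow>
    (\<forall>x y u. f ((1 - u) *\<^sub>R x + u *\<^sub>R y) = (1 - u) *\<^sub>R f x + u *\<^sub>R f y)"

definition pointed_convex_cone :: "'a::real_vector set \<Rightarrow> bool"
  where "pointed_convex_cone K \<longleftrightarrow> convex_cone K \<and> K \<inter> uminus ` K = {0}"

definition oriented_affine_map ::
    "('a::real_vector \<Rightarrow> 'b::real_vector) \<Rightarrow> 'b set \<Rightarrow> bool"
  where "oriented_affine_map f P \<longleftrightarrow> affine_map f \<and> pointed_convex_cone P"

definition positive_on :: "('a \<Rightarrow> 'b) \<Rightarrow> 'b set \<Rightarrow> 'a set \<Rightarrow> bool"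
  where "positive_on f P S \<longleftrightarrow> f ` S \<subseteq> P"

definition kernel :: "('a \<Rightarrow> 'b::zero) \<Rightarrow> 'a set"
  where "kernel f = f -` {0}"

text \<open>
  The target of the oriented affine map ranges over all real vector spaces, and a
  definition in HOL cannot quantify over types. The type \<open>'a \<times> real\<close> is large enough to
  serve as the only target: the theorem \<open>faceI\<close> below shows that an oriented affine map
  into an arbitrary real vector space yields a face in the sense of this definition.
\<close>

definition face :: "'a::real_vector set \<Rightarrow> 'a set \<Rightarrow> bool"
  where "face C F \<longleftrightarrow>
    (\<exists>(f :: 'a \<Rightarrow> 'a \<times> real) P.
       oriented_affine_map f P \<and> positive_on f P C \<and> F = C \<inter> kernel f)"

text \<open>The order on sets is inclusion, so \<open>LEAST\<close> selects the smallest such face.\<close>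

definition generated_face :: "'a::real_vector set \<Rightarrow> 'a set \<Rightarrow> 'a set"
  where "generated_face C D = (LEAST F. face C F \<and> C \<inter> D \<subseteq> F)"

lemma affine_map_linear_part:
  assumes "affine_map f"
  shows "linear (\<lambda>x. f x - f 0)"
proof -
  have scale: "f (u *\<^sub>R x) - f 0 = u *\<^sub>R (f x - f 0)" for u x
  proof -
    have "f ((1 - u) *\<^sub>R 0 + u *\<^sub>R x) = (1 - u) *\<^sub>R f 0 + u *\<^sub>R f x"
      using assms unfolding affine_map_def by blast
    then show ?thesis by (simp add: algebra_simps)
  qed
  have add: "f (x + y) - f 0 = (f x - f 0) + (f y - f 0)" for x y
  proof -
    have "f ((1 - 1/2) *\<^sub>R x + (1/2) *\<^sub>R y) = (1 - 1/2) *\<^sub>R f x + (1/2) *\<^sub>R f y"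
      using assms unfolding affine_map_def by blast
    then have mid: "f ((1/2) *\<^sub>R (x + y)) = (1/2) *\<^sub>R (f x + f y)"
      by (simp add: scaleR_right_distrib)
    have "f (x + y) - f 0 = 2 *\<^sub>R (f ((1/2) *\<^sub>R (x + y)) - f 0)"
      using scale[of 2 "(1/2) *\<^sub>R (x + y)"] by simp
    also have "\<dots> = (f x - f 0) + (f y - f 0)"
      unfolding mid by (simp add: algebra_simps scaleR_2)
    finally show ?thesis .
  qed
  show ?thesis by (rule linearI) (simp_all only: scale add)
qed

lemma affine_map_linear_plus:
  assumes "linear L"
  shows "affine_map (\<lambda>x. L x + c)"
  unfolding affine_map_def
  by (simp only: linear_add[OF assms] linear_scale[OF assms]) (simp add: algebra_simps)

lemma pointed_convex_cone_vimage:
  assumes P: "pointed_convex_cone P" and h: "linear h" and S: "subspace S"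
    and inj: "\<And>y. y \<in> S \<Longrightarrow> h y = 0 \<Longrightarrow> y = 0"
  shows "pointed_convex_cone (S \<inter> h -` P)"
proof -
  have cone: "convex_cone P" and pt: "P \<inter> uminus ` P = {0}"
    using P by (auto simp: pointed_convex_cone_def)
  have "convex_cone (S \<inter> h -` P)"
    using cone S unfolding convex_cone_iff subspace_def
    by (simp add: linear_add[OF h] linear_scale[OF h] linear_0[OF h])
  moreover have "y = 0" if "y \<in> S" "h y \<in> P" "h (- y) \<in> P" for y
  proof -
    have "h y \<in> P \<inter> uminus ` P"
      using that by (metis IntI image_eqI linear_neg[OF h] minus_minus)
    then show ?thesis using pt inj that by blast
  qed
  ultimately show ?thesis
    unfolding pointed_convex_cone_def using linear_0[OF h] convex_cone_contains_0
    by (fastforce simp: image_iff)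
qed

theorem faceI:
  fixes f :: "'a::real_vector \<Rightarrow> 'b::real_vector"
  assumes f: "oriented_affine_map f P" and pos: "positive_on f P C"
  shows "face C (C \<inter> kernel f)"
proof -
  define L where "L = (\<lambda>x. f x - f 0)"
  have aff: "affine_map f" and P: "pointed_convex_cone P"
    using f by (auto simp: oriented_affine_map_def)
  have L: "linear L" unfolding L_def by (rule affine_map_linear_part[OF aff])
  have fL: "f x = L x + f 0" for x by (simp add: L_def)
  obtain g where g: "linear g" and gL: "\<And>x. L (g (L x)) = L x"
  proof -
    have "\<exists>g. range g \<subseteq> UNIV \<and> linear g \<and> (\<forall>v\<in>L ` UNIV. L (g v) = v)"
      by (rule real_vector.linear_exists_right_inverse_on[of L UNIV, folded linear_def])
         (simp_all add: L)
    then show thesis using that by blast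
  qed
  have gLl: "linear (\<lambda>x. g (L x))"
    using linear_compose[OF L g] by (simp add: o_def)
  define V where "V = range (\<lambda>x. g (L x))"
  have V: "subspace V" unfolding V_def by (rule linear_subspace_image[OF gLl]) simp
  have V0: "v = 0" if "v \<in> V" "L v = 0" for v
    using that linear_0[OF g] by (auto simp: V_def gL)
  obtain f' :: "'a \<Rightarrow> 'a \<times> real" and S h where f': "affine_map f'"
    and S: "subspace S" and h: "linear h"
    and inj: "\<And>y. y \<in> S \<Longrightarrow> h y = 0 \<Longrightarrow> y = 0"
    and f'S: "\<And>x. f' x \<in> S" and hf': "\<And>x. h (f' x) = f x"
  proof (cases "f 0 \<in> range L")
    case True
    then obtain z where z: "f 0 = L z" by blast
    show thesis
    proof (rule that[of "\<lambda>x. (g (L x), 0) + (g (L z), 0)" "V \<times> {0}" "\<lambda>y. L (fst y)"])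
      have "linear (\<lambda>x. (g (L x), 0::real))"
        by (rule linearI) (simp_all add: linear_add[OF gLl] linear_scale[OF gLl])
      then show "affine_map (\<lambda>x. (g (L x), 0::real) + (g (L z), 0))"
        by (rule affine_map_linear_plus)
      show "subspace (V \<times> {0::real})" by (rule subspace_Times[OF V]) simp
      show "linear (\<lambda>y::'a \<times> real. L (fst y))"
        by (rule linearI) (simp_all add: linear_add[OF L] linear_scale[OF L])
      show "y = 0" if "y \<in> V \<times> {0}" "L (fst y) = 0" for y :: "'a \<times> real"
        using that V0 by (auto simp: zero_prod_def)
      show "(g (L x), 0::real) + (g (L z), 0) \<in> V \<times> {0}" for x
        using subspace_add[OF V] by (auto simp: V_def)
      show "L (fst ((g (L x), 0::real) + (g (L z), 0))) = f x" for x
        by (simp add: linear_add[OF L] gL fL[of x] z)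
    qed
  next
    case False
    show thesis
    proof (rule that[of "\<lambda>x. (g (L x), 0) + (0, 1)" "V \<times> UNIV"
          "\<lambda>y. L (fst y) + snd y *\<^sub>R f 0"])
      have "linear (\<lambda>x. (g (L x), 0::real))"
        by (rule linearI) (simp_all add: linear_add[OF gLl] linear_scale[OF gLl])
      then show "affine_map (\<lambda>x. (g (L x), 0::real) + (0, 1))"
        by (rule affine_map_linear_plus)
      show "subspace (V \<times> (UNIV::real set))" by (rule subspace_Times[OF V]) simp
      show "linear (\<lambda>y::'a \<times> real. L (fst y) + snd y *\<^sub>R f 0)"
        by (rule linearI)
           (simp_all add: linear_add[OF L] linear_scale[OF L] algebra_simps)
      show "y = 0" if y: "y \<in> V \<times> UNIV" "L (fst y) + snd y *\<^sub>R f 0 = 0"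
        for y :: "'a \<times> real"
      proof -
        have "snd y = 0"
        proof (rule ccontr)
          assume t: "snd y \<noteq> 0"
          have "snd y *\<^sub>R f 0 = - L (fst y)" using y(2) by (simp add: eq_neg_iff_add_eq_0 add.commute)
          then have "(1 / snd y) *\<^sub>R (snd y *\<^sub>R f 0) = (1 / snd y) *\<^sub>R (- L (fst y))" by simp
          then have "f 0 = L ((- 1 / snd y) *\<^sub>R fst y)"
            using t by (simp add: linear_scale[OF L] linear_neg[OF L])
          then show False using False by blast
        qed
        then show ?thesis using y V0 by (auto simp: prod_eq_iff)
      qed
      show "(g (L x), 0::real) + (0, 1) \<in> V \<times> UNIV" for x
        by (auto simp: V_def)
      show "L (fst ((g (L x), 0::real) + (0, 1)))
          + snd ((g (L x), 0::real) + (0, 1)) *\<^sub>R f 0 = f x" for x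
        by (simp add: gL fL[of x])
    qed
  qed
  have "oriented_affine_map f' (S \<inter> h -` P)"
    unfolding oriented_affine_map_def
    using f' pointed_convex_cone_vimage[OF P h S inj] by blast
  moreover have "positive_on f' (S \<inter> h -` P) C"
    using pos f'S hf' by (auto simp: positive_on_def)
  moreover have "f' x = 0 \<longleftrightarrow> f x = 0" for x
    using inj[OF f'S, of x] hf'[of x] linear_0[OF h] by auto
  then have "C \<inter> kernel f = C \<inter> kernel f'" by (auto simp: kernel_def)
  ultimately show ?thesis unfolding face_def by blast
qed

end

theory Submission
  imports Defs
begin

text \<open>
  For convex \<open>C\<close>, the faces of \<open>C\<close> are exactly its extreme convex subsets \<open>F\<close>: the projection
  along the lineality space of the cone generated by \<open>C - F\<close> maps this cone to a pointed one, and
  its kernel cuts \<open>F\<close> out of \<open>C\<close>. Consequently, for convex \<open>A \<subseteq> C\<close>, the face \<open>F\<^sub>C(A)\<close> consists of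
  the \<open>x \<in> C\<close> for which some \<open>a \<in> A\<close> is a convex combination, with positive weight at \<open>x\<close>, of \<open>x\<close>
  and another point of \<open>C\<close>. If \<open>x\<close> lies in \<open>F\<^sub>C(A)\<close> and in \<open>F\<^sub>D(A)\<close>, a weighted mean \<open>m \<in> A\<close> of the
  two corresponding points of \<open>A\<close> is a convex combination of \<open>x\<close> and a point of \<open>C \<inter> D\<close>, so
  \<open>x \<in> A\<close> by extremality.
\<close>

section \<open>Weighted means with unnormalized weights\<close>

lemma convex_weighted_mean:
  assumes "convex C" "x \<in> C" "y \<in> C" "0 \<le> p" "0 \<le> q" "0 < p + q"
  obtains w where "w \<in> C" "(p + q) *\<^sub>R w = p *\<^sub>R x + q *\<^sub>R y"
proof
  show "(p / (p + q)) *\<^sub>R x + (q / (p + q)) *\<^sub>R y \<in> C"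
    using assms by (intro convexD) (auto simp flip: add_divide_distrib)
  show "(p + q) *\<^sub>R ((p / (p + q)) *\<^sub>R x + (q / (p + q)) *\<^sub>R y) = p *\<^sub>R x + q *\<^sub>R y"
    using assms by (simp add: scaleR_right_distrib)
qed

text \<open>The condition in \<open>face_of\<close> only concerns open segments. If
  \<open>x = y\<close> or \<open>q = 0\<close>, there is no such segment through \<open>a\<close>,
  but then \<open>a = x\<close>.\<close>

lemma face_of_weighted_mean:
  assumes F: "F face_of C" and "x \<in> C" "y \<in> C" "a \<in> F" and p: "0 < p" and q: "0 \<le> q"
    and a: "(p + q) *\<^sub>R a = p *\<^sub>R x + q *\<^sub>R y"
  shows "x \<in> F"
proof (cases "x = y \<or> q = 0")
  case True
  then have "(p + q) *\<^sub>R a = (p + q) *\<^sub>R x"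
    using a by (auto simp: scaleR_left_distrib)
  then show ?thesis using p q \<open>a \<in> F\<close> by simp
next
  case False
  have "a = (1 / (p + q)) *\<^sub>R ((p + q) *\<^sub>R a)" using p q by simp
  also have "\<dots> = (1 - q / (p + q)) *\<^sub>R x + (q / (p + q)) *\<^sub>R y"
    unfolding a using p q by (simp add: scaleR_right_distrib field_simps)
  finally have "a \<in> open_segment x y"
    using False p q by (auto simp: in_segment intro!: exI[of _ "q / (p + q)"])
  then show ?thesis using assms by (auto simp: face_of_def)
qed

section \<open>Faces as extreme convex subsets\<close>

text \<open>If \<open>f\<close> vanishes inside a segment of \<open>C\<close>, the weighted values
  at its ends are opposite elements of the pointed cone \<open>P\<close>, hence both are 0.\<close>

lemma face_imp_face_of:
  assumes C: "convex C" and F: "face C F"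
  shows "F face_of C"
proof -
  obtain f :: "'a \<Rightarrow> 'a \<times> real" and P
    where fP: "oriented_affine_map f P" "positive_on f P C" and FC: "F = C \<inter> kernel f"
    using F unfolding face_def by blast
  have P: "convex_cone P" and pt: "P \<inter> uminus ` P = {0}" and pos: "\<And>x. x \<in> C \<Longrightarrow> f x \<in> P"
    and f: "\<And>x y u. f ((1 - u) *\<^sub>R x + u *\<^sub>R y) = (1 - u) *\<^sub>R f x + u *\<^sub>R f y"
    using fP unfolding oriented_affine_map_def affine_map_def pointed_convex_cone_def positive_on_def
    by blast+
  have extreme: "f x = 0"
    if "x \<in> C" "y \<in> C" "0 < u" "u < 1" "(1 - u) *\<^sub>R f x + u *\<^sub>R f y = 0" for x y u
  proof -
    have "(1 - u) *\<^sub>R f x \<in> P" "u *\<^sub>R f y \<in> P"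
      using P pos that by (auto simp: convex_cone_iff)
    moreover have "(1 - u) *\<^sub>R f x = - (u *\<^sub>R f y)"
      using that by (simp add: eq_neg_iff_add_eq_0)
    ultimately have "(1 - u) *\<^sub>R f x = 0" using pt by blast
    then show ?thesis using that by simp
  qed
  have "x \<in> F \<and> y \<in> F"
    if xy: "x \<in> C" "y \<in> C" and z: "z \<in> F" "z \<in> open_segment x y" for x y z
  proof -
    obtain u where u: "0 < u" "u < 1" and zu: "z = (1 - u) *\<^sub>R x + u *\<^sub>R y"
      using z by (auto simp: in_segment)
    have "(1 - u) *\<^sub>R f x + u *\<^sub>R f y = 0"
      using z(1) unfolding zu FC by (simp add: kernel_def f)
    then show ?thesis
      using extreme[OF xy u] extreme[OF xy(2,1), of "1 - u"] u xy
      by (simp add: FC kernel_def add.commute)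
  qed
  moreover have "convex F"
    using C by (auto simp: convex_alt FC kernel_def f)
  ultimately show ?thesis
    unfolding face_of_def using FC by blast
qed

text \<open>This is the quotient by the lineality space, realised inside the same type:
  \<open>q\<close> is the identity minus a linear projection onto \<open>L\<close>.\<close>

lemma convex_cone_quotient_lineality:
  fixes K :: "'a::real_vector set"
  assumes K: "convex_cone K"
  obtains q :: "'a \<Rightarrow> 'a" where "linear q" "pointed_convex_cone (q ` K)"
    "\<And>x. q x = 0 \<longleftrightarrow> x \<in> K \<and> - x \<in> K"
proof -
  define L where "L = {x. x \<in> K \<and> - x \<in> K}"
  have add: "x + y \<in> K" if "x \<in> K" "y \<in> K" for x y
    using K that by (simp add: convex_cone_iff)
  have scale: "c *\<^sub>R x \<in> K" if "x \<in> K" "0 \<le> c" for x c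
    using K that by (simp add: convex_cone_iff)
  have L: "subspace L"
  proof (rule subspaceI)
    show "0 \<in> L" using K by (simp add: L_def convex_cone_iff)
    show "x + y \<in> L" if "x \<in> L" "y \<in> L" for x y
      using that add[of x y] add[of "- x" "- y"] by (simp add: L_def)
    show "c *\<^sub>R x \<in> L" if "x \<in> L" for c x
      using that scale[of x c] scale[of "- x" c] scale[of x "- c"] scale[of "- x" "- c"]
      by (cases "0 \<le> c") (auto simp: L_def)
  qed
  have "\<exists>g. range g \<subseteq> L \<and> linear g \<and> (\<forall>v\<in>L. g (id v) = v)"
    by (rule real_vector.linear_exists_left_inverse_on[of id L, folded linear_def])
       (use L in \<open>auto simp: linear_id\<close>)
  then obtain g where gL: "\<And>x. g x \<in> L" and g: "linear g" and gid: "\<And>v. v \<in> L \<Longrightarrow> g v = v"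
    by auto
  define q where "q x = x - g x" for x
  have q: "linear q"
    unfolding q_def using linear_compose_sub[OF linear_id g] by simp
  have q0: "q x = 0 \<longleftrightarrow> x \<in> L" for x
    using gL[of x] gid[of x] by (auto simp: q_def)
  have "convex_cone (q ` K)"
    using K q by (blast intro: convex_cone_linear_image)
  moreover have "q x = 0" if "x \<in> K" "y \<in> K" "q x = - q y" for x y
  proof -
    have "x + y \<in> L" using that by (simp flip: q0 add: linear_add[OF q])
    \<comment> \<open>This vector is \<open>- x\<close>, so \<open>x\<close> belongs to the
      lineality space.\<close>
    then have "y + - (x + y) \<in> K" using that add unfolding L_def by blast
    then have "x \<in> L" using that by (simp add: L_def)
    then show ?thesis by (simp only: q0)
  qed
  ultimately have "pointed_convex_cone (q ` K)"
    unfolding pointed_convex_cone_def using linear_0[OF q] K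
    by (fastforce simp: convex_cone_iff image_iff)
  with q q0 that show thesis by (simp add: L_def)
qed

lemma face_of_imp_face:
  fixes C :: "'a::real_vector set"
  assumes C: "convex C" and F: "F face_of C"
  shows "face C F"
proof (cases "F = {}")
  case True
  \<comment> \<open>A nonzero positive constant has empty kernel, which yields the empty
    face.\<close>
  have "oriented_affine_map (\<lambda>x::'a. 1::real) {0..}"
    by (auto simp: oriented_affine_map_def affine_map_def pointed_convex_cone_def convex_cone_iff)
  then have "face C (C \<inter> kernel (\<lambda>x::'a. 1::real))"
    by (rule faceI) (auto simp: positive_on_def)
  then show ?thesis using True by (simp add: kernel_def)
next
  case False
  then obtain a where a: "a \<in> F" by blast
  have FC: "F \<subseteq> C" and cF: "convex F" using F by (auto simp: face_of_def)
  define K where "K = {t *\<^sub>R (c - b) | t c b. 0 \<le> t \<and> c \<in> C \<and> b \<in> F}"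
  have K: "convex_cone K"
    unfolding convex_cone_iff
  proof (intro conjI ballI allI impI)
    show "0 \<in> K" unfolding K_def using a FC by force
    show "s *\<^sub>R x \<in> K" if "x \<in> K" "0 \<le> s" for x s
      using that unfolding K_def by (force intro: mult_nonneg_nonneg)
    show "x + x' \<in> K" if "x \<in> K" "x' \<in> K" for x x'
    proof -
      obtain t c b t' c' b' where x: "x = t *\<^sub>R (c - b)" "0 \<le> t" "c \<in> C" "b \<in> F"
        and x': "x' = t' *\<^sub>R (c' - b')" "0 \<le> t'" "c' \<in> C" "b' \<in> F"
        using \<open>x \<in> K\<close> \<open>x' \<in> K\<close> unfolding K_def by blast
      show ?thesis
      proof (cases "t + t' = 0")
        case True
        then show ?thesis using x x' \<open>0 \<in> K\<close> by (simp add: add_nonneg_eq_0_iff)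
      next
        case False
        then have t: "0 < t + t'" using x x' by simp
        \<comment> \<open>Averaging the points of \<open>C\<close> and those of \<open>F\<close>
          with the same weights \<open>t\<close>, \<open>t'\<close> turns the sum into a single
          generator.\<close>
        obtain d where d: "d \<in> C" "(t + t') *\<^sub>R d = t *\<^sub>R c + t' *\<^sub>R c'"
          using convex_weighted_mean[OF C x(3) x'(3) x(2) x'(2) t] .
        obtain e where e: "e \<in> F" "(t + t') *\<^sub>R e = t *\<^sub>R b + t' *\<^sub>R b'"
          using convex_weighted_mean[OF cF x(4) x'(4) x(2) x'(2) t] .
        have "x + x' = (t + t') *\<^sub>R (d - e)"
          unfolding scaleR_right_diff_distrib[of "t + t'"] d e x x' by (simp add: algebra_simps)
        then show ?thesis using t d e unfolding K_def by force
      qed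
    qed
  qed
  obtain q :: "'a \<Rightarrow> 'a" where q: "linear q" and qK: "pointed_convex_cone (q ` K)"
    and q0: "\<And>x. q x = 0 \<longleftrightarrow> x \<in> K \<and> - x \<in> K"
    using convex_cone_quotient_lineality[OF K] by blast
  have sub: "c - b \<in> K" if "c \<in> C" "b \<in> F" for c b
    using that unfolding K_def by (force intro: exI[of _ 1])
  define f where "f x = q x + - q a" for x
  have fq: "f x = q (x - a)" for x by (simp add: f_def linear_diff[OF q])
  have "oriented_affine_map f (q ` K)"
    unfolding oriented_affine_map_def f_def using qK affine_map_linear_plus[OF q] by blast
  moreover have "positive_on f (q ` K) C"
    using sub a by (auto simp: positive_on_def fq)
  ultimately have "face C (C \<inter> kernel f)" by (rule faceI)
  moreover have "x \<in> F \<longleftrightarrow> x - a \<in> K \<and> - (x - a) \<in> K" if x: "x \<in> C" for x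
  proof
    assume "x \<in> F"
    then show "x - a \<in> K \<and> - (x - a) \<in> K" using sub[of x a] sub[of a x] a FC by auto
  next
    assume "x - a \<in> K \<and> - (x - a) \<in> K"
    then obtain t c b where t: "0 \<le> t" and c: "c \<in> C" and b: "b \<in> F"
      and eq: "a - x = t *\<^sub>R (c - b)"
      unfolding K_def by auto
    have "0 < 1 + t" using t by simp
    \<comment> \<open>Rearranging \<open>eq\<close> gives \<open>a + t b = x + t c\<close>. So the
      mean \<open>m\<close> of two points of \<open>F\<close> is also a mean of \<open>x\<close> and
      \<open>c\<close>, and extremality applies to \<open>x\<close>.\<close>
    then obtain m where m: "m \<in> F" "(1 + t) *\<^sub>R m = 1 *\<^sub>R a + t *\<^sub>R b"
      using convex_weighted_mean[OF cF a b _ t, of 1] by auto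
    have "(1 + t) *\<^sub>R m = 1 *\<^sub>R x + t *\<^sub>R c"
      unfolding m using eq by (simp add: algebra_simps)
    then show "x \<in> F" using face_of_weighted_mean[OF F x c m(1) _ t, of 1] by simp
  qed
  then have "C \<inter> kernel f = F" using FC by (auto simp: kernel_def fq q0)
  ultimately show ?thesis by simp
qed

lemma face_iff_face_of:
  "convex C \<Longrightarrow> face C F \<longleftrightarrow> F face_of C"
  using face_imp_face_of face_of_imp_face by blast

section \<open>Explicit description of generated faces\<close>

text \<open>The weight at \<open>x\<close> is normalised to 1, which encodes its positivity;
  \<open>q = 0\<close> is allowed so that points of \<open>A\<close> lying in \<open>C\<close> are
  included.\<close>

definition segment_extension :: "'a::real_vector set \<Rightarrow> 'a set \<Rightarrow> 'a set"
  where "segment_extension C A =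
    {x \<in> C. \<exists>a\<in>A. \<exists>y\<in>C. \<exists>q\<ge>0. (1 + q) *\<^sub>R a = x + q *\<^sub>R y}"

lemma segment_extensionI:
  assumes "x \<in> C" "a \<in> A" "y \<in> C" and p: "0 < p" and q: "0 \<le> q"
    and a: "(p + q) *\<^sub>R a = p *\<^sub>R x + q *\<^sub>R y"
  shows "x \<in> segment_extension C A"
proof -
  have "(1 + q / p) *\<^sub>R a = (1 / p) *\<^sub>R ((p + q) *\<^sub>R a)"
    using p by (simp add: add_divide_distrib)
  also have "\<dots> = x + (q / p) *\<^sub>R y" unfolding a using p by (simp add: scaleR_right_distrib)
  finally show ?thesis
    unfolding segment_extension_def using assms by (auto intro!: bexI exI[of _ "q / p"])
qed

lemma face_of_segment_extension:
  assumes C: "convex C" and A: "convex A"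
  shows "segment_extension C A face_of C"
proof -
  let ?E = "segment_extension C A"
  have extreme: "x \<in> ?E"
    if xy: "x \<in> C" "y \<in> C" and u: "0 < u" "u < 1" and z: "(1 - u) *\<^sub>R x + u *\<^sub>R y \<in> ?E" for x y u
  proof -
    obtain a w q where a: "a \<in> A" and w: "w \<in> C" and q: "0 \<le> q"
      and eq: "(1 + q) *\<^sub>R a = ((1 - u) *\<^sub>R x + u *\<^sub>R y) + q *\<^sub>R w"
      using z unfolding segment_extension_def by blast
    \<comment> \<open>The point \<open>v\<close> absorbs \<open>y\<close> and \<open>w\<close>,
      leaving \<open>a\<close> as a mean of \<open>x\<close> and \<open>v\<close> in which
      \<open>x\<close> keeps the positive weight \<open>1 - u\<close>.\<close>
    obtain v where v: "v \<in> C" "(u + q) *\<^sub>R v = u *\<^sub>R y + q *\<^sub>R w"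
      using convex_weighted_mean[OF C xy(2) w, of u q] u q by auto
    have "((1 - u) + (u + q)) *\<^sub>R a = (1 - u) *\<^sub>R x + (u + q) *\<^sub>R v"
      unfolding v using eq by (simp add: add.assoc)
    then show ?thesis
      using u q by (intro segment_extensionI[OF xy(1) a v(1), of "1 - u" "u + q"]) auto
  qed
  have "x \<in> ?E \<and> y \<in> ?E"
    if xy: "x \<in> C" "y \<in> C" and z: "z \<in> ?E" "z \<in> open_segment x y" for x y z
  proof -
    obtain u where u: "0 < u" "u < 1" and zu: "z = (1 - u) *\<^sub>R x + u *\<^sub>R y"
      using z by (auto simp: in_segment)
    show ?thesis
      using extreme[OF xy u] extreme[OF xy(2,1), of "1 - u"] u z(1) by (simp add: zu add.commute)
  qed
  moreover have "convex ?E"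
  proof (rule convexI)
    fix x x' and u v :: real
    assume x: "x \<in> ?E" and x': "x' \<in> ?E" and u: "0 \<le> u" and v: "0 \<le> v" and uv: "u + v = 1"
    obtain a y q where a: "a \<in> A" "y \<in> C" "0 \<le> q" "(1 + q) *\<^sub>R a = x + q *\<^sub>R y" and xC: "x \<in> C"
      using x unfolding segment_extension_def by blast
    obtain a' y' q' where a': "a' \<in> A" "y' \<in> C" "0 \<le> q'" "(1 + q') *\<^sub>R a' = x' + q' *\<^sub>R y'"
      and xC': "x' \<in> C"
      using x' unfolding segment_extension_def by blast
    \<comment> \<open>\<open>r\<close> is the total weight of \<open>y\<close> and \<open>y'\<close>
      once the two equations are combined with coefficients \<open>u\<close> and
      \<open>v\<close>.\<close>
    define r where "r = u * q + v * q'"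
    have r: "0 \<le> r" using u v a a' by (simp add: r_def)
    have r1: "u * (1 + q) + v * (1 + q') = 1 + r" using uv by (simp add: r_def algebra_simps)
    obtain m where m: "m \<in> A" "(1 + r) *\<^sub>R m = (u * (1 + q)) *\<^sub>R a + (v * (1 + q')) *\<^sub>R a'"
      using convex_weighted_mean[OF A a(1) a'(1), of "u * (1 + q)" "v * (1 + q')"] u v a a' r
      unfolding r1 by auto
    \<comment> \<open>For \<open>r = 0\<close> no mean can be formed, but both sides vanish and any
      point of \<open>C\<close> will do.\<close>
    have w: "\<exists>w\<in>C. r *\<^sub>R w = (u * q) *\<^sub>R y + (v * q') *\<^sub>R y'"
    proof (cases "r = 0")
      case True
      then have "u * q = 0" "v * q' = 0"
        using u v a a' by (simp_all add: r_def add_nonneg_eq_0_iff)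
      then show ?thesis using True a by auto
    next
      case False
      then show ?thesis
        using convex_weighted_mean[OF C a(2) a'(2), of "u * q" "v * q'"] u v a a' r
        unfolding r_def by (metis less_eq_real_def mult_nonneg_nonneg)
    qed
    then obtain w where w: "w \<in> C" "r *\<^sub>R w = (u * q) *\<^sub>R y + (v * q') *\<^sub>R y'" by blast
    have "(1 + r) *\<^sub>R m = u *\<^sub>R ((1 + q) *\<^sub>R a) + v *\<^sub>R ((1 + q') *\<^sub>R a')"
      using m by simp
    also have "\<dots> = 1 *\<^sub>R (u *\<^sub>R x + v *\<^sub>R x') + r *\<^sub>R w"
      unfolding a a' w by (simp add: scaleR_right_distrib)
    finally show "u *\<^sub>R x + v *\<^sub>R x' \<in> ?E"
      using convexD[OF C xC xC' u v uv] m w r by (intro segment_extensionI[of _ C m A w 1 r]) auto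
  qed
  moreover have "?E \<subseteq> C" by (auto simp: segment_extension_def)
  ultimately show ?thesis unfolding face_of_def by blast
qed

text \<open>The extension is itself a face containing \<open>A\<close>, and extremality forces every
  face containing \<open>A\<close> to contain it.\<close>

lemma generated_face_eq_segment_extension:
  assumes C: "convex C" and A: "convex A" and AC: "A \<subseteq> C"
  shows "generated_face C A = segment_extension C A"
  unfolding generated_face_def
proof (rule Least_equality)
  have "A \<subseteq> segment_extension C A"
    using AC by (auto intro: segment_extensionI[where p = 1 and q = 0])
  then show "face C (segment_extension C A) \<and> C \<inter> A \<subseteq> segment_extension C A"
    using face_of_segment_extension[OF C A] C by (auto simp: face_iff_face_of)
next
  fix F assume F: "face C F \<and> C \<inter> A \<subseteq> F"
  show "segment_extension C A \<subseteq> F"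
  proof
    fix x assume "x \<in> segment_extension C A"
    then obtain a y q where x: "x \<in> C" and "a \<in> A" "y \<in> C" "0 \<le> q" "(1 + q) *\<^sub>R a = x + q *\<^sub>R y"
      unfolding segment_extension_def by blast
    then show "x \<in> F"
      using F AC C face_of_weighted_mean[of F C x y a 1 q] by (auto simp: face_iff_face_of)
  qed
qed

theorem theorem6p2:
  fixes C D A :: "'a::real_vector set"
  assumes "convex C" and "convex D"
    and "face (C \<inter> D) A"
  shows "A = generated_face C A \<inter> generated_face D A"
proof -
  have F: "A face_of C \<inter> D"
    using assms by (simp add: face_iff_face_of convex_Int)
  then have A: "convex A" and AC: "A \<subseteq> C" and AD: "A \<subseteq> D"
    by (auto simp: face_of_def)
  have "x \<in> A" if x: "x \<in> segment_extension C A" "x \<in> segment_extension D A" for x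
  proof -
    obtain a y q where a: "a \<in> A" "y \<in> C" "0 \<le> q" "(1 + q) *\<^sub>R a = x + q *\<^sub>R y" and xC: "x \<in> C"
      using x(1) unfolding segment_extension_def by blast
    obtain b z r where b: "b \<in> A" "z \<in> D" "0 \<le> r" "(1 + r) *\<^sub>R b = x + r *\<^sub>R z" and xD: "x \<in> D"
      using x(2) unfolding segment_extension_def by blast
    \<comment> \<open>The right-hand side equals \<open>2 x + q y + r z\<close>. Splitting off one
      \<open>x\<close> leaves \<open>x + q y + r z\<close>, which is a multiple of a point of
      \<open>C\<close> when grouped as \<open>(1 + r) b + q y\<close>, and of a point of
      \<open>D\<close> when grouped as \<open>(1 + q) a + r z\<close>. The total weights agree, so
      \<open>w\<close> and \<open>w'\<close> coincide and lie in both sets.\<close>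
    obtain m where m: "m \<in> A" "((1 + q) + (1 + r)) *\<^sub>R m = (1 + q) *\<^sub>R a + (1 + r) *\<^sub>R b"
      using convex_weighted_mean[OF A a(1) b(1), of "1 + q" "1 + r"] a b by auto
    obtain w where w: "w \<in> C" "((1 + r) + q) *\<^sub>R w = (1 + r) *\<^sub>R b + q *\<^sub>R y"
      using convex_weighted_mean[OF assms(1) subsetD[OF AC b(1)] a(2), of "1 + r" q] a b by auto
    obtain w' where w': "w' \<in> D" "((1 + q) + r) *\<^sub>R w' = (1 + q) *\<^sub>R a + r *\<^sub>R z"
      using convex_weighted_mean[OF assms(2) subsetD[OF AD a(1)] b(2), of "1 + q" r] a b by auto
    have "((1 + r) + q) *\<^sub>R w = ((1 + r) + q) *\<^sub>R w'"
      using w(2) w'(2) unfolding a(4) b(4) by (simp add: ac_simps)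
    then have "w = w'" using a b by simp
    then have wCD: "w \<in> C \<inter> D" using w w' by simp
    have "(1 + ((1 + r) + q)) *\<^sub>R m = 1 *\<^sub>R x + ((1 + r) + q) *\<^sub>R w"
      unfolding w(2) using m(2) unfolding a(4) by (simp add: ac_simps)
    then show ?thesis
      using face_of_weighted_mean[OF F _ wCD m(1), of x 1 "(1 + r) + q"] xC xD a b by auto
  qed
  moreover have "A \<subseteq> segment_extension C A \<inter> segment_extension D A"
    using AC AD by (auto intro: segment_extensionI[where p = 1 and q = 0])
  ultimately show ?thesis
    using generated_face_eq_segment_extension assms A AC AD by blast
qed

end
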